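(* For $s \ge t \ge 2$, let $G=P_s \square P_t$ be the grid graph with vertex set $\{(u_i,w_j):1\le i\le s,\ 1\le j\le t\}$, and let $L=\bigcup_{i=1}^t\{(u_1,w_i),(u_s,w_i) \}$. Then (a) $\mathrm{cdim}(G)=t$; (b) for $v \in V(G)$, $$\mathrm{cdim}_G(v)=\begin{cases} t & \text{if } s=t \text{ and } \deg_G(v) \le 3, \text{ or } s>t \text{ and } v\in L,\\ t+1 & \text{if } s=t \text{ and } \deg_G(v)=4, \text{ or } s>t \text{ and } v \not\in L.\end{cases}$$
   Context: $P_s$ is the path $u_1,\ldots,u_s$ and $P_t$ is the path $w_1,\ldots,w_t$. The Cartesian product $G\square H$ has vertex set $V(G)\times V(H)$, with $(u,w)$ adjacent to $(u',w')$ iff either $u=u'$ and $ww'\in E(H)$, or $w=w'$ and $uu'\in E(G)$. A set $S\subseteq V(G)$ is a resolving set of a connected graph $G$ if for every pair of distinct vertices $x,y$ of $G$ there is $z\in S$ with $d(x,z)\ne d(y,z)$ ($d$ is the shortest-path distance); it is a connected resolving set if moreover the induced subgraph $G[S]$ is connected. $\mathrm{cdim}(G)$ is the minimum cardinality of a connected resolving set of $G$, and $\mathrm{cdim}_G(v)$ is the minimum cardinality of a connected resolving set containing $v$. *)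

theory Defs
  imports "Graph_Theory.Graph_Theory"
begin

text \<open>
  Simple graphs are loop-free symmetric digraphs without parallel arcs (locale
  \<^locale>\<open>pair_graph\<close>): every edge is represented by its two orientations.
\<close>

definition path_graph :: "nat \<Rightarrow> nat pair_pre_digraph" where
  "path_graph n = \<lparr> pverts = {1..n},
     parcs = {(i, j). i \<in> {1..n} \<and> j \<in> {1..n} \<and> (j = i + 1 \<or> i = j + 1)} \<rparr>"

definition cartesian_product ::
  "'a pair_pre_digraph \<Rightarrow> 'b pair_pre_digraph \<Rightarrow> ('a \<times> 'b) pair_pre_digraph" where
  "cartesian_product G H = \<lparr> pverts = pverts G \<times> pverts H,
     parcs = {((u, w), (u', w')).
        (u = u' \<and> u \<in> pverts G \<and> (w, w') \<in> parcs H)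
      \<or> (w = w' \<and> w \<in> pverts H \<and> (u, u') \<in> parcs G)} \<rparr>"

lemma pair_graph_path_graph: "pair_graph (path_graph n)"
proof
  have "parcs (path_graph n) \<subseteq> {1..n} \<times> {1..n}"
    by (auto simp: path_graph_def)
  then show "finite (parcs (path_graph n))"
    by (rule finite_subset) simp
  show "symmetric (with_proj (path_graph n))"
    by (auto simp: symmetric_def sym_def path_graph_def)
qed (auto simp: path_graph_def)

lemma pair_graph_cartesian_product:
  assumes "pair_graph G" "pair_graph H"
  shows "pair_graph (cartesian_product G H)"
proof -
  interpret G: pair_graph G by fact
  interpret H: pair_graph H by fact
  have sub: "parcs (cartesian_product G H)
      \<subseteq> (pverts G \<times> pverts H) \<times> (pverts G \<times> pverts H)"
    by (auto simp: cartesian_product_def dest: G.in_arcsD1 G.in_arcsD2 H.in_arcsD1 H.in_arcsD2)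
  show ?thesis
  proof
    show "finite (pverts (cartesian_product G H))"
      by (simp add: cartesian_product_def)
    show "finite (parcs (cartesian_product G H))"
      using sub by (rule finite_subset) simp
    show "symmetric (with_proj (cartesian_product G H))"
      by (auto simp: symmetric_def sym_def cartesian_product_def
          intro: G.arcs_symmetric H.arcs_symmetric)
    fix e assume e: "e \<in> parcs (cartesian_product G H)"
    with sub have "e \<in> (pverts G \<times> pverts H) \<times> (pverts G \<times> pverts H)" ..
    then show "fst e \<in> pverts (cartesian_product G H)"
      and "snd e \<in> pverts (cartesian_product G H)"
      by (auto simp: cartesian_product_def)
    from e show "fst e \<noteq> snd e"
      by (auto simp: cartesian_product_def dest: G.no_loops' H.no_loops')
  qed
qed

text \<open>The shortest-path distance is the least cost of a walk when every arc has cost \<open>1\<close>.\<close>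

definition gdist :: "'a pair_pre_digraph \<Rightarrow> 'a \<Rightarrow> 'a \<Rightarrow> ereal" where
  "gdist G u v = wf_digraph.\<mu> (with_proj G) (\<lambda>_. 1) u v"

text \<open>In a symmetric digraph, the out-degree counts each edge at a vertex once.\<close>

definition degree :: "'a pair_pre_digraph \<Rightarrow> 'a \<Rightarrow> nat" where
  "degree G v = out_degree (with_proj G) v"

definition resolving_set :: "'a pair_pre_digraph \<Rightarrow> 'a set \<Rightarrow> bool" where
  "resolving_set G S \<longleftrightarrow> S \<subseteq> pverts G \<and>
     (\<forall>x\<in>pverts G. \<forall>y\<in>pverts G. x \<noteq> y \<longrightarrow> (\<exists>z\<in>S. gdist G x z \<noteq> gdist G y z))"

text \<open>The name \<open>connected\<close> is qualified to exclude topological connectedness.\<close>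

definition connected_resolving_set :: "'a pair_pre_digraph \<Rightarrow> 'a set \<Rightarrow> bool" where
  "connected_resolving_set G S \<longleftrightarrow>
     resolving_set G S \<and> Digraph_Component.connected (induce_subgraph (with_proj G) S)"

text \<open>
  In a finite connected graph the sets of cardinalities below are non-empty (the whole
  vertex set qualifies), so that \<^const>\<open>Inf\<close> on \<^typ>\<open>nat\<close> is the minimum.
\<close>

definition cdim :: "'a pair_pre_digraph \<Rightarrow> nat" where
  "cdim G = Inf (card ` {S. connected_resolving_set G S})"

definition cdim_at :: "'a pair_pre_digraph \<Rightarrow> 'a \<Rightarrow> nat" where
  "cdim_at G v = Inf (card ` {S. connected_resolving_set G S \<and> v \<in> S})"

end

theory Submission
  imports Defs
begin

text \<open>
  Distances in the grid are Manhattan distances, so being a resolving set is a condition on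
  coordinates; column \<open>p\<close> consists of the vertices \<open>(p, _)\<close> and row \<open>q\<close> of the vertices \<open>(_, q)\<close>.
  Look at a corner and its two neighbours: these two are equidistant from every
  vertex lying on neither of the two border lines through that corner.  A resolving set \<open>S\<close>
  therefore meets, at each of the four corners, one of the two border lines that form it.  A short
  case distinction shows that \<open>S\<close> then meets both the first and the last row, or both the first
  and the last column.  A connected \<open>S\<close> cannot skip a line in between, so it meets all \<open>t\<close> rows or
  all \<open>s\<close> columns (\<open>resolving_meets_all_lines\<close>), and \<open>card S \<ge> t\<close>.

  If \<open>card S = t\<close> and \<open>S\<close> meets every row, it has one vertex in each row.  Connectedness forces
  vertices in consecutive rows to be vertically adjacent, hence \<open>S\<close> is a whole column.  An inner
  column does not separate a pair of vertices that are mirror images in it, so the column is the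
  first or the last one (\<open>minimum_resolving_is_outer_column\<close>).  If \<open>S\<close> meets every column instead,
  then \<open>s = t\<close> and the transposed argument makes \<open>S\<close> an outer row.

  Conversely, the two ends of a column determine the row of a vertex and its distance to that
  column.  This settles the position for an outer column, and for an inner column one extra
  vertex beside it tells the two sides apart.  So every vertex of an outer column lies in a
  connected resolving set of size \<open>t\<close>, in the square case so does every vertex of an outer row by
  transposition, and every vertex of an inner column lies in one of size \<open>t + 1\<close>.
  The degrees in the square case only say whether a vertex lies on the border.
\<close>

section \<open>The grid and its distances\<close>

abbreviation grid :: "nat \<Rightarrow> nat \<Rightarrow> (nat \<times> nat) pair_pre_digraph" where
  "grid s t \<equiv> cartesian_product (path_graph s) (path_graph t)"

definition manhattan :: "nat \<times> nat \<Rightarrow> nat \<times> nat \<Rightarrow> int" where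
  "manhattan x y = \<bar>int (fst x) - int (fst y)\<bar> + \<bar>int (snd x) - int (snd y)\<bar>"

lemma pverts_grid: "pverts (grid s t) = {1..s} \<times> {1..t}"
  by (simp add: cartesian_product_def path_graph_def)

lemma parcs_grid:
  "parcs (grid s t) = {(x, y). x \<in> {1..s} \<times> {1..t} \<and> y \<in> {1..s} \<times> {1..t} \<and> manhattan x y = 1}"
  by (auto simp: cartesian_product_def path_graph_def manhattan_def)

lemma manhattan_swap: "manhattan (prod.swap x) (prod.swap y) = manhattan x y"
  by (simp add: manhattan_def)

lemma manhattan_sym: "manhattan x y = manhattan y x"
  by (simp add: manhattan_def abs_minus_commute)

lemma manhattan_triangle: "manhattan x z \<le> manhattan x y + manhattan y z"
  by (simp add: manhattan_def)

lemma manhattan_step_towards: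
  assumes "u \<in> {1..s} \<times> {1..t}" "v \<in> {1..s} \<times> {1..t}" "u \<noteq> v"
  obtains u' where "u' \<in> {1..s} \<times> {1..t}" "manhattan u u' = 1"
    "manhattan u v = manhattan u' v + 1"
proof -
  obtain a b c d where uv: "u = (a, b)" "v = (c, d)" by (metis surj_pair)
  consider "a < c" | "c < a" | "b < d" | "d < b"
    using assms(3) uv by fastforce
  then show thesis
  proof cases
    case 1 then show thesis
      using assms uv by (intro that[of "(a + 1, b)"]) (auto simp: manhattan_def)
  next
    case 2 then show thesis
      using assms uv by (intro that[of "(a - 1, b)"]) (auto simp: manhattan_def)
  next
    case 3 then show thesis
      using assms uv by (intro that[of "(a, b + 1)"]) (auto simp: manhattan_def)
  next
    case 4 then show thesis
      using assms uv by (intro that[of "(a, b - 1)"]) (auto simp: manhattan_def)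
  qed
qed

text \<open>
  An edge lowers the Manhattan distance to a fixed target by at most one, and away from the target
  some edge lowers it by exactly one; so no walk is shorter and some walk is equally long.
\<close>
lemma gdist_grid:
  assumes "u \<in> {1..s} \<times> {1..t}" "v \<in> {1..s} \<times> {1..t}"
  shows "gdist (grid s t) u v = ereal (real_of_int (manhattan u v))"
proof -
  interpret pair_graph "grid s t"
    by (intro pair_graph_cartesian_product pair_graph_path_graph)
  have cost: "awalk_cost (\<lambda>_. 1) p = real (length p)" for p :: "((nat \<times> nat) \<times> (nat \<times> nat)) list"
    by (induction p) auto
  have lower: "manhattan u v \<le> int (length p)" if "awalk u p v" for u p
    using that
  proof (induction p arbitrary: u)
    case Nil
    then show ?case by (simp add: awalk_Nil_iff manhattan_def)
  next
    case (Cons e p)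
    then have "e \<in> parcs (grid s t)" "fst e = u" and walk: "awalk (snd e) p v"
      by (auto simp: awalk_Cons_iff)
    then have "manhattan u (snd e) = 1"
      by (auto simp: parcs_grid)
    then show ?case
      using Cons.IH[OF walk] manhattan_triangle[of u v "snd e"] by simp
  qed
  have upper: "\<exists>p. awalk u p v \<and> int (length p) = manhattan u v"
    using assms
  proof (induction "nat (manhattan u v)" arbitrary: u rule: less_induct)
    case less
    show ?case
    proof (cases "u = v")
      case True
      then show ?thesis
        using less.prems by (intro exI[of _ "[]"]) (auto simp: awalk_Nil_iff pverts_grid manhattan_def)
    next
      case False
      then obtain u' where u': "u' \<in> {1..s} \<times> {1..t}" "manhattan u u' = 1"
          "manhattan u v = manhattan u' v + 1"
        using less.prems by (metis manhattan_step_towards)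
      have "0 \<le> manhattan u' v" by (simp add: manhattan_def)
      then have "nat (manhattan u' v) < nat (manhattan u v)"
        using u'(3) by linarith
      then obtain p where p: "awalk u' p v" "int (length p) = manhattan u' v"
        using less.hyps u'(1) less.prems(2) by blast
      have "(u, u') \<in> parcs (grid s t)"
        using u' less.prems(1) unfolding parcs_grid by blast
      then have "awalk u ((u, u') # p) v"
        using p(1) by (auto simp: awalk_Cons_iff)
      then show ?thesis
        using p(2) u'(3) by (intro exI[of _ "(u, u') # p"]) simp
    qed
  qed
  show ?thesis
  proof (rule antisym)
    obtain p where "awalk u p v" "int (length p) = manhattan u v"
      using upper by blast
    then show "gdist (grid s t) u v \<le> ereal (real_of_int (manhattan u v))"
      unfolding gdist_def using min_cost_le_walk_cost[of u p v "\<lambda>_. 1"]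
      by (metis cost of_int_of_nat_eq)
    show "ereal (real_of_int (manhattan u v)) \<le> gdist (grid s t) u v"
      unfolding gdist_def \<mu>_def
    proof (rule INF_greatest)
      fix p assume "p \<in> {p. awalk u p v}"
      then have "manhattan u v \<le> int (length p)" using lower by simp
      then have "real_of_int (manhattan u v) \<le> real (length p)" by linarith
      then show "ereal (real_of_int (manhattan u v)) \<le> ereal (awalk_cost (\<lambda>_. 1) p)"
        by (simp add: cost)
    qed
  qed
qed

section \<open>Connectedness as the absence of a cut\<close>

text \<open>
  Connectedness in terms of sets that no edge leaves: this form speaks of adjacency only, is visibly
  invariant under transposition, and yields crossing edges without following walks.
\<close>
lemma connected_induced_iff_no_cut:
  assumes "pair_graph G" "S \<subseteq> pverts G"
  shows "Digraph_Component.connected (induce_subgraph (with_proj G) S) \<longleftrightarrow>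
    S \<noteq> {} \<and> (\<forall>T\<subseteq>S. T \<noteq> {} \<longrightarrow> (\<forall>x\<in>T. \<forall>y\<in>S. (x, y) \<in> parcs G \<longrightarrow> y \<in> T) \<longrightarrow> T = S)"
    (is "?conn \<longleftrightarrow> S \<noteq> {} \<and> ?nocut")
proof -
  interpret pair_graph G by fact
  let ?M = "mk_symmetric (induce_subgraph (with_proj G) S)"
  have arcsM: "(x, y) \<in> parcs ?M \<longleftrightarrow> x \<in> S \<and> y \<in> S \<and> (x, y) \<in> parcs G" for x y
    using arcs_symmetric by (auto simp: parcs_mk_symmetric)
  have reach_def: "x \<rightarrow>\<^sup>*\<^bsub>with_proj ?M\<^esub> y \<longleftrightarrow> (x, y) \<in> rtrancl_on S (parcs ?M)" for x y
    by (simp add: reachable_def)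
  show ?thesis
  proof (intro iffI conjI)
    assume ?conn
    then have ne: "S \<noteq> {}" and reach: "\<And>x y. x \<in> S \<Longrightarrow> y \<in> S \<Longrightarrow> (x, y) \<in> rtrancl_on S (parcs ?M)"
      by (auto simp: Digraph_Component.connected_def strongly_connected_def reach_def)
    show "S \<noteq> {}" by fact
    show ?nocut
    proof (intro allI impI)
      fix T assume T: "T \<subseteq> S" "T \<noteq> {}" "\<forall>x\<in>T. \<forall>y\<in>S. (x, y) \<in> parcs G \<longrightarrow> y \<in> T"
      then obtain a where a: "a \<in> T" by blast
      have "y \<in> T" if "y \<in> S" for y
      proof -
        have "(a, y) \<in> rtrancl_on S (parcs ?M)"
          using reach a T(1) that by blast
        then show ?thesis
          using a T(3) by (induction rule: rtrancl_on_induct) (auto simp: arcsM)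
      qed
      then show "T = S" using T(1) by blast
    qed
  next
    assume R: "S \<noteq> {} \<and> ?nocut"
    have "(a, y) \<in> rtrancl_on S (parcs ?M)" if "a \<in> S" "y \<in> S" for a y
    proof -
      \<comment> \<open>No edge leaves the set of vertices reachable from \<open>a\<close>, so that set is all of \<open>S\<close>.\<close>
      let ?T = "{z \<in> S. (a, z) \<in> rtrancl_on S (parcs ?M)}"
      have "a \<in> ?T" using that by simp
      moreover have "\<forall>x\<in>?T. \<forall>y\<in>S. (x, y) \<in> parcs G \<longrightarrow> y \<in> ?T"
        by (auto intro: rtrancl_on_into_rtrancl_on simp: arcsM)
      moreover have "?T \<subseteq> S" by blast
      ultimately have "?T = S" using R by (metis (no_types, lifting) empty_iff)
      then show ?thesis using that by blast
    qed
    then show ?conn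
      using R by (auto simp: Digraph_Component.connected_def strongly_connected_def reach_def)
  qed
qed

text \<open>
  The cut condition above with adjacency read off the Manhattan distance, which for subsets of a grid
  is independent of its side lengths.
\<close>
definition grid_linked :: "(nat \<times> nat) set \<Rightarrow> bool" where
  "grid_linked S \<longleftrightarrow> S \<noteq> {} \<and>
     (\<forall>T\<subseteq>S. T \<noteq> {} \<longrightarrow> (\<forall>x\<in>T. \<forall>y\<in>S. manhattan x y = 1 \<longrightarrow> y \<in> T) \<longrightarrow> T = S)"

lemma connected_resolving_set_grid_iff:
  "connected_resolving_set (grid s t) S \<longleftrightarrow>
     S \<subseteq> {1..s} \<times> {1..t} \<and>
     (\<forall>x\<in>{1..s} \<times> {1..t}. \<forall>y\<in>{1..s} \<times> {1..t}. x \<noteq> y \<longrightarrow>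
        (\<exists>z\<in>S. manhattan x z \<noteq> manhattan y z)) \<and>
     grid_linked S"
proof (cases "S \<subseteq> {1..s} \<times> {1..t}")
  case True
  have "Digraph_Component.connected (induce_subgraph (with_proj (grid s t)) S) \<longleftrightarrow> grid_linked S"
  proof -
    have "(x, y) \<in> parcs (grid s t) \<longleftrightarrow> manhattan x y = 1" if "x \<in> S" "y \<in> S" for x y
      using True that unfolding parcs_grid by blast
    then have "(\<forall>x\<in>T. \<forall>y\<in>S. (x, y) \<in> parcs (grid s t) \<longrightarrow> y \<in> T) \<longleftrightarrow>
        (\<forall>x\<in>T. \<forall>y\<in>S. manhattan x y = 1 \<longrightarrow> y \<in> T)" if "T \<subseteq> S" for T
      using that by blast
    then show ?thesis
      using True unfolding grid_linked_def
      by (subst connected_induced_iff_no_cut)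
        (auto simp: pverts_grid pair_graph_cartesian_product pair_graph_path_graph cong: imp_cong)
  qed
  moreover have "gdist (grid s t) x z = gdist (grid s t) y z \<longleftrightarrow> manhattan x z = manhattan y z"
    if "x \<in> {1..s} \<times> {1..t}" "y \<in> {1..s} \<times> {1..t}" "z \<in> S" for x y z
    using that True by (subst (1 2) gdist_grid) auto
  then have "(\<exists>z\<in>S. gdist (grid s t) x z \<noteq> gdist (grid s t) y z) \<longleftrightarrow>
      (\<exists>z\<in>S. manhattan x z \<noteq> manhattan y z)"
    if "x \<in> {1..s} \<times> {1..t}" "y \<in> {1..s} \<times> {1..t}" for x y
    using that by blast
  ultimately show ?thesis
    using True unfolding connected_resolving_set_def resolving_set_def pverts_grid by blast
next
  case False
  then show ?thesis
    by (simp add: connected_resolving_set_def resolving_set_def pverts_grid)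
qed

lemma connected_resolving_set_gridD:
  assumes "connected_resolving_set (grid s t) S"
  shows "S \<subseteq> {1..s} \<times> {1..t}" "grid_linked S"
    and "\<lbrakk>x \<in> {1..s} \<times> {1..t}; y \<in> {1..s} \<times> {1..t}; x \<noteq> y\<rbrakk>
      \<Longrightarrow> \<exists>z\<in>S. manhattan x z \<noteq> manhattan y z"
proof -
  note S = assms[unfolded connected_resolving_set_grid_iff]
  show "S \<subseteq> {1..s} \<times> {1..t}" using S by (rule conjunct1)
  show "grid_linked S" using S[THEN conjunct2] by (rule conjunct2)
  show "\<exists>z\<in>S. manhattan x z \<noteq> manhattan y z"
    if "x \<in> {1..s} \<times> {1..t}" "y \<in> {1..s} \<times> {1..t}" "x \<noteq> y"
    using S[THEN conjunct2, THEN conjunct1, THEN bspec, OF that(1), THEN bspec, OF that(2)] that(3)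
    by (rule mp)
qed

lemma grid_linked_swap:
  assumes "grid_linked S"
  shows "grid_linked (prod.swap ` S)"
  unfolding grid_linked_def
proof (intro conjI allI impI)
  show "prod.swap ` S \<noteq> {}" using assms by (simp add: grid_linked_def)
  fix T assume T: "T \<subseteq> prod.swap ` S" "T \<noteq> {}"
    "\<forall>x\<in>T. \<forall>y\<in>prod.swap ` S. manhattan x y = 1 \<longrightarrow> y \<in> T"
  have "prod.swap ` T \<subseteq> S" using T(1) by auto
  moreover have "prod.swap ` T \<noteq> {}" using T(2) by simp
  moreover have "\<forall>x\<in>prod.swap ` T. \<forall>y\<in>S. manhattan x y = 1 \<longrightarrow> y \<in> prod.swap ` T"
  proof (intro ballI impI)
    fix x y assume xy: "x \<in> prod.swap ` T" "y \<in> S" "manhattan x y = 1"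
    obtain x' where "x' \<in> T" "x = prod.swap x'" using xy(1) by (rule imageE)
    then have "prod.swap x \<in> T" by simp
    moreover have "prod.swap y \<in> prod.swap ` S" using xy(2) by (rule imageI)
    moreover have "manhattan (prod.swap x) (prod.swap y) = 1"
      using xy(3) by (simp only: manhattan_swap)
    ultimately have "prod.swap y \<in> T" using T(3) by blast
    then have "prod.swap (prod.swap y) \<in> prod.swap ` T" by (rule imageI)
    then show "y \<in> prod.swap ` T" by simp
  qed
  ultimately have "prod.swap ` T = S" using assms unfolding grid_linked_def by blast
  then have "prod.swap ` S = prod.swap ` prod.swap ` T" by simp
  also have "\<dots> = T" by (simp add: image_image)
  finally show "T = prod.swap ` S" by simp
qed

text \<open>Transposing the grid; this lets rows stand in for columns below.\<close>
lemma connected_resolving_set_swap: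
  assumes "connected_resolving_set (grid s t) S"
  shows "connected_resolving_set (grid t s) (prod.swap ` S)"
  unfolding connected_resolving_set_grid_iff
proof (intro conjI ballI impI)
  note S = connected_resolving_set_gridD[OF assms]
  show "prod.swap ` S \<subseteq> {1..t} \<times> {1..s}" using S(1) by auto
  show "grid_linked (prod.swap ` S)" using S(2) by (rule grid_linked_swap)
  fix x y assume xy: "x \<in> {1..t} \<times> {1..s}" "y \<in> {1..t} \<times> {1..s}" "x \<noteq> y"
  then have "prod.swap x \<in> {1..s} \<times> {1..t}" "prod.swap y \<in> {1..s} \<times> {1..t}"
    "prod.swap x \<noteq> prod.swap y"
    by auto
  then have "\<exists>z\<in>S. manhattan (prod.swap x) z \<noteq> manhattan (prod.swap y) z"
    by (rule S(3))
  then obtain z where z: "z \<in> S" "manhattan (prod.swap x) z \<noteq> manhattan (prod.swap y) z"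
    by (rule bexE)
  then have "manhattan x (prod.swap z) \<noteq> manhattan y (prod.swap z)"
    using manhattan_swap[of x "prod.swap z"] manhattan_swap[of y "prod.swap z"] by simp
  then show "\<exists>z\<in>prod.swap ` S. manhattan x z \<noteq> manhattan y z"
    using z(1) by blast
qed

lemma grid_linked_singleton: "grid_linked {x}"
  by (auto simp: grid_linked_def)

lemma grid_linked_insert:
  assumes "grid_linked S" "b \<in> S" "manhattan b a = 1"
  shows "grid_linked (insert a S)"
  unfolding grid_linked_def
proof (intro conjI allI impI)
  show "insert a S \<noteq> {}" by simp
  fix T assume T: "T \<subseteq> insert a S" "T \<noteq> {}"
    "\<forall>x\<in>T. \<forall>y\<in>insert a S. manhattan x y = 1 \<longrightarrow> y \<in> T"
  have "manhattan a b = 1" using assms(3) by (simp add: manhattan_sym)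
  then have "T \<inter> S \<noteq> {}" using T assms(2) by blast
  then have "T \<inter> S = S"
    using assms(1) T(3) unfolding grid_linked_def by blast
  moreover from this have "a \<in> T" using T(3) assms(2,3) by blast
  ultimately show "T = insert a S" using T(1) by blast
qed

lemma grid_linked_column: "grid_linked ({p} \<times> {1..Suc n})"
proof (induction n)
  case 0
  show ?case using grid_linked_singleton[of "(p, 1)"] by simp
next
  case (Suc n)
  have "grid_linked (insert (p, Suc (Suc n)) ({p} \<times> {1..Suc n}))"
    using Suc by (rule grid_linked_insert[where b = "(p, Suc n)"]) (auto simp: manhattan_def)
  moreover have "insert (p, Suc (Suc n)) ({p} \<times> {1..Suc n}) = {p} \<times> {1..Suc (Suc n)}"
    by auto
  ultimately show ?case by simp
qed

text \<open>
  An edge of the grid that changes the row keeps the column, so the edge by which a connected set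
  passes from row \<open>m\<close> to row \<open>m + 1\<close> is vertical.
\<close>
lemma grid_linked_crosses_rows:
  assumes "grid_linked S" "x \<in> S" "y \<in> S" "snd x \<le> m" "m < snd y"
  obtains p where "(p, m) \<in> S" "(p, m + 1) \<in> S"
proof -
  let ?T = "{z \<in> S. snd z \<le> m}"
  have "x \<in> ?T" "y \<in> S - ?T" using assms by auto
  then have "?T \<subseteq> S" "?T \<noteq> {}" "?T \<noteq> S" by blast+
  then have "\<not> (\<forall>a\<in>?T. \<forall>b\<in>S. manhattan a b = 1 \<longrightarrow> b \<in> ?T)"
    using assms(1) unfolding grid_linked_def by blast
  then obtain a b where ab: "a \<in> ?T" "b \<in> S" "manhattan a b = 1" "b \<notin> ?T"
    by blast
  then have "fst a = fst b" "snd a = m" "snd b = m + 1"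
    by (auto simp: manhattan_def)
  then have "a = (fst a, m)" "b = (fst a, m + 1)"
    by (simp_all add: prod_eq_iff)
  then show thesis
    using ab(1,2) by (intro that[of "fst a"]) (metis mem_Collect_eq, metis)
qed

section \<open>Lower bounds\<close>

lemma snd_image_full:
  assumes "S \<subseteq> {1..s} \<times> {1..t}" "grid_linked S" "1 \<in> snd ` S" "t \<in> snd ` S"
  shows "snd ` S = {1..t}"
proof
  show "snd ` S \<subseteq> {1..t}" using assms(1) by auto
  show "{1..t} \<subseteq> snd ` S"
  proof
    fix m assume m: "m \<in> {1..t}"
    show "m \<in> snd ` S"
    proof (cases "m = t")
      case True
      then show ?thesis using assms(4) by simp
    next
      case False
      obtain x y where "x \<in> S" "snd x = 1" "y \<in> S" "snd y = t"
        using assms(3,4) by (metis imageE)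
      then obtain p where "(p, m) \<in> S"
        using grid_linked_crosses_rows[OF assms(2), of x y m] m False by force
      then show ?thesis by force
    qed
  qed
qed

text \<open>
  The two neighbours of a corner are equidistant from every vertex off both border lines through
  that corner.  Each disjunction below is this observation at one corner.
\<close>
lemma resolving_meets_all_lines:
  assumes "connected_resolving_set (grid s t) S" "s \<ge> 2" "t \<ge> 2"
  shows "snd ` S = {1..t} \<or> fst ` S = {1..s}"
proof -
  note S = connected_resolving_set_gridD(1,2)[OF assms(1)]
  note res = connected_resolving_set_gridD(3)[OF assms(1)]
  have bounds: "1 \<le> fst z \<and> fst z \<le> s \<and> 1 \<le> snd z \<and> snd z \<le> t" if "z \<in> S" for z
    using S(1) that by auto
  have "1 \<in> fst ` S \<or> 1 \<in> snd ` S"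
  proof -
    obtain z where z: "z \<in> S" "manhattan (2, 1) z \<noteq> manhattan (1, 2) z"
      using res[of "(2, 1)" "(1, 2)"] assms(2,3) by force
    then have "fst z = 1 \<or> snd z = 1" using bounds[OF z(1)] by (auto simp: manhattan_def)
    then show ?thesis using z(1) by (metis imageI)
  qed
  moreover have "s \<in> fst ` S \<or> 1 \<in> snd ` S"
  proof -
    obtain z where z: "z \<in> S" "manhattan (s - 1, 1) z \<noteq> manhattan (s, 2) z"
      using res[of "(s - 1, 1)" "(s, 2)"] assms(2,3) by force
    then have "fst z = s \<or> snd z = 1"
      using bounds[OF z(1)] assms by (auto simp: manhattan_def)
    then show ?thesis using z(1) by (metis imageI)
  qed
  moreover have "1 \<in> fst ` S \<or> t \<in> snd ` S"
  proof -
    obtain z where z: "z \<in> S" "manhattan (1, t - 1) z \<noteq> manhattan (2, t) z"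
      using res[of "(1, t - 1)" "(2, t)"] assms(2,3) by force
    then have "fst z = 1 \<or> snd z = t"
      using bounds[OF z(1)] assms by (auto simp: manhattan_def)
    then show ?thesis using z(1) by (metis imageI)
  qed
  moreover have "s \<in> fst ` S \<or> t \<in> snd ` S"
  proof -
    obtain z where z: "z \<in> S" "manhattan (s - 1, t) z \<noteq> manhattan (s, t - 1) z"
      using res[of "(s - 1, t)" "(s, t - 1)"] assms(2,3) by force
    then have "fst z = s \<or> snd z = t"
      using bounds[OF z(1)] assms by (auto simp: manhattan_def)
    then show ?thesis using z(1) by (metis imageI)
  qed
  ultimately have "(1 \<in> snd ` S \<and> t \<in> snd ` S) \<or> (1 \<in> fst ` S \<and> s \<in> fst ` S)" by blast
  then show ?thesis
  proof
    assume "1 \<in> snd ` S \<and> t \<in> snd ` S"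
    then show ?thesis using snd_image_full[OF S] by blast
  next
    assume "1 \<in> fst ` S \<and> s \<in> fst ` S"
    moreover have swap: "snd ` prod.swap ` S = fst ` S" by (simp add: image_image)
    moreover have "prod.swap ` S \<subseteq> {1..t} \<times> {1..s}" using S(1) by auto
    ultimately show ?thesis
      using snd_image_full[of "prod.swap ` S" t s] grid_linked_swap[OF S(2)] by simp
  qed
qed

lemma finite_connected_resolving_set:
  assumes "connected_resolving_set (grid s t) S"
  shows "finite S"
  using connected_resolving_set_gridD(1)[OF assms] by (rule finite_subset) simp

lemma card_connected_resolving_set_ge:
  assumes "connected_resolving_set (grid s t) S" "s \<ge> t" "t \<ge> 2"
  shows "card S \<ge> t"
proof -
  have "finite S" using assms(1) by (rule finite_connected_resolving_set)
  then have "card (snd ` S) \<le> card S" "card (fst ` S) \<le> card S"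
    by (auto intro: card_image_le)
  then show ?thesis
    using resolving_meets_all_lines[OF assms(1)] assms(2,3) by auto
qed

lemma minimum_resolving_is_outer_column:
  assumes crs: "connected_resolving_set (grid s t) S" and "t \<ge> 1"
    and full: "snd ` S = {1..t}" and card: "card S = t"
  obtains p where "p \<in> {1, s}" "S = {p} \<times> {1..t}"
proof -
  note S = connected_resolving_set_gridD[OF crs]
  have inj: "inj_on snd S"
    using full card by (intro eq_card_imp_inj_on finite_connected_resolving_set[OF crs]) simp
  obtain p where p: "(p, 1) \<in> S"
    using full \<open>t \<ge> 1\<close> by (metis atLeastAtMost_iff imageE order_refl prod.collapse)
  have col: "(p, Suc n) \<in> S" if "Suc n \<le> t" for n
    using that
  proof (induction n)
    case 0
    show ?case using p by simp
  next
    case (Suc n)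
    then have pn: "(p, Suc n) \<in> S" by simp
    obtain y where "y \<in> S" "snd y = Suc (Suc n)"
      using full Suc.prems by (metis One_nat_def Suc_le_mono atLeastAtMost_iff imageE le0)
    then obtain q where q: "(q, Suc n) \<in> S" "(q, Suc n + 1) \<in> S"
      using grid_linked_crosses_rows[of S "(p, Suc n)" y "Suc n"] S(2) pn by auto
    \<comment> \<open>Row \<open>Suc n\<close> has a single vertex of \<open>S\<close>, so the crossing edge starts at it.\<close>
    moreover have "q = p" using inj_onD[OF inj _ q(1) pn] by simp
    ultimately show ?case by simp
  qed
  have "{p} \<times> {1..t} \<subseteq> S"
  proof clarify
    fix m assume "m \<in> {1..t}"
    then show "(p, m) \<in> S" using col[of "m - 1"] by simp
  qed
  then have eq: "{p} \<times> {1..t} = S"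
    using card by (intro card_subset_eq finite_connected_resolving_set[OF crs]) simp_all
  have "p \<in> {1, s}"
  proof (rule ccontr)
    assume "p \<notin> {1, s}"
    moreover have "p \<in> {1..s}" using S(1) p by auto
    ultimately have inner: "1 < p" "p < s" by auto
    \<comment> \<open>Mirror images in column \<open>p\<close> are equidistant from all of that column.\<close>
    have "(p - 1, 1) \<in> {1..s} \<times> {1..t}" "(p + 1, 1) \<in> {1..s} \<times> {1..t}"
      "(p - 1, 1) \<noteq> (p + 1, 1 :: nat)"
      using inner \<open>t \<ge> 1\<close> by auto
    then obtain z where "z \<in> S" "manhattan (p - 1, 1) z \<noteq> manhattan (p + 1, 1) z"
      using S(3) by meson
    then show False
      using eq inner by (auto simp: manhattan_def)
  qed
  then show thesis using that eq by blast
qed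

section \<open>Connected resolving sets that attain the bounds\<close>

text \<open>From the ends of column \<open>p\<close> one reads off the sum and the difference of
  \<open>\<bar>fst x - p\<bar>\<close> and \<open>snd x\<close>, up to constants.\<close>
lemma column_ends_determine:
  assumes "x \<in> {1..s} \<times> {1..t}" "y \<in> {1..s} \<times> {1..t}"
    and "manhattan x (p, 1) = manhattan y (p, 1)" "manhattan x (p, t) = manhattan y (p, t)"
  shows "snd x = snd y" "\<bar>int (fst x) - int p\<bar> = \<bar>int (fst y) - int p\<bar>"
  using assms by (auto simp: manhattan_def)

lemma grid_linked_full_column:
  assumes "t \<ge> 1"
  shows "grid_linked ({p} \<times> {1..t})"
  using grid_linked_column[of p "t - 1"] assms by simp

lemma outer_column_resolving:
  assumes "p \<in> {1, s}" "s \<ge> 1" "t \<ge> 1"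
  shows "connected_resolving_set (grid s t) ({p} \<times> {1..t})"
  unfolding connected_resolving_set_grid_iff
proof (intro conjI ballI impI)
  show "{p} \<times> {1..t} \<subseteq> {1..s} \<times> {1..t}" using assms by auto
  show "grid_linked ({p} \<times> {1..t})" using assms(3) by (rule grid_linked_full_column)
  fix x y assume xy: "x \<in> {1..s} \<times> {1..t}" "y \<in> {1..s} \<times> {1..t}" "x \<noteq> y"
  show "\<exists>z\<in>{p} \<times> {1..t}. manhattan x z \<noteq> manhattan y z"
  proof (rule ccontr)
    assume "\<not> ?thesis"
    then have "manhattan x (p, 1) = manhattan y (p, 1)" "manhattan x (p, t) = manhattan y (p, t)"
      using assms(3) by auto
    note column_ends_determine[OF xy(1,2) this]
    then show False using xy assms(1) by (auto simp: prod_eq_iff)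
  qed
qed

lemma thickened_column_resolving:
  assumes "1 \<le> p" "p < s" "t \<ge> 1"
  shows "connected_resolving_set (grid s t) (insert (p + 1, 1) ({p} \<times> {1..t}))"
    (is "connected_resolving_set _ ?S")
  unfolding connected_resolving_set_grid_iff
proof (intro conjI ballI impI)
  show "?S \<subseteq> {1..s} \<times> {1..t}" using assms by auto
  show "grid_linked ?S"
    using grid_linked_full_column[OF assms(3)]
    by (rule grid_linked_insert[where b = "(p, 1)"]) (use assms in \<open>auto simp: manhattan_def\<close>)
  fix x y assume xy: "x \<in> {1..s} \<times> {1..t}" "y \<in> {1..s} \<times> {1..t}" "x \<noteq> y"
  show "\<exists>z\<in>?S. manhattan x z \<noteq> manhattan y z"
  proof (rule ccontr)
    assume "\<not> ?thesis"
    then have eq: "manhattan x (p, 1) = manhattan y (p, 1)" "manhattan x (p, t) = manhattan y (p, t)"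
      "manhattan x (p + 1, 1) = manhattan y (p + 1, 1)"
      using assms(3) by auto
    note col = column_ends_determine[OF xy(1,2) eq(1,2)]
    then have "fst x \<noteq> fst y" using xy(3) by (simp add: prod_eq_iff)
    \<comment> \<open>Only mirror images in column \<open>p\<close> are left, and the extra vertex is nearer to the one in the higher column.\<close>
    then show False using col eq(3) by (auto simp: manhattan_def split: abs_split)
  qed
qed

section \<open>Degrees\<close>

lemma degree_grid:
  "degree (grid s t) v = card {y. (v, y) \<in> parcs (grid s t)}"
proof -
  have "out_arcs (with_proj (grid s t)) v = Pair v ` {y. (v, y) \<in> parcs (grid s t)}"
    by (auto simp: out_arcs_def)
  then show ?thesis
    by (simp add: degree_def out_degree_def card_image inj_on_def)
qed

lemma finite_grid_neighbours: "finite {y. (v, y) \<in> parcs (grid s t)}"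
  by (rule finite_subset[of _ "{1..s} \<times> {1..t}"]) (auto simp: parcs_grid)

lemma degree_grid_inner:
  assumes "1 < i" "i < s" "1 < j" "j < t"
  shows "degree (grid s t) (i, j) \<ge> 4"
proof -
  let ?N = "{(i - 1, j), (i + 1, j), (i, j - 1), (i, j + 1)}"
  have "card ?N = 4" using assms by auto
  moreover have "?N \<subseteq> {y. ((i, j), y) \<in> parcs (grid s t)}"
    using assms by (auto simp: parcs_grid manhattan_def)
  ultimately show ?thesis
    unfolding degree_grid using card_mono[OF finite_grid_neighbours] by metis
qed

lemma degree_grid_border:
  assumes "(i, j) \<in> {1..s} \<times> {1..t}" "i \<in> {1, s} \<or> j \<in> {1, t}"
  shows "degree (grid s t) (i, j) \<le> 3"
proof -
  \<comment> \<open>One of the four possible neighbours, on a side where the grid ends.\<close>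
  let ?out = "if i = 1 then (i - 1, j) else if i = s then (i + 1, j)
    else if j = 1 then (i, j - 1) else (i, j + 1)"
  let ?N = "{(i - 1, j), (i + 1, j), (i, j - 1), (i, j + 1)}"
  have mem: "?out \<in> ?N" by auto
  have "{y. ((i, j), y) \<in> parcs (grid s t)} \<subseteq> ?N \<inter> {1..s} \<times> {1..t}"
    by (auto simp: cartesian_product_def path_graph_def)
  moreover have "?out \<notin> {1..s} \<times> {1..t}"
    using assms by auto
  ultimately have "{y. ((i, j), y) \<in> parcs (grid s t)} \<subseteq> ?N - {?out}"
    by blast
  then have "degree (grid s t) (i, j) \<le> card (?N - {?out})"
    unfolding degree_grid by (intro card_mono) auto
  also have "\<dots> = card ?N - 1" using mem by (rule card_Diff_singleton)
  also have "\<dots> \<le> 4 - 1"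
    using card_length[of "[(i - 1, j), (i + 1, j), (i, j - 1), (i, j + 1)]"]
    by (intro diff_le_mono) simp
  finally show ?thesis by simp
qed

section \<open>Connected metric dimension of the grid\<close>

lemma cdim_at_eqI:
  assumes "connected_resolving_set G S" "v \<in> S" "card S = n"
    and "\<And>S. connected_resolving_set G S \<Longrightarrow> v \<in> S \<Longrightarrow> n \<le> card S"
  shows "cdim_at G v = n"
  unfolding cdim_at_def by (rule cInf_eq_minimum) (use assms in auto)

lemma minimum_resolving_on_border:
  assumes crs: "connected_resolving_set (grid s t) S" and card: "card S = t"
    and st: "s \<ge> t" "t \<ge> 2" and v: "v \<in> S"
  shows "fst v \<in> {1, s} \<or> (s = t \<and> snd v \<in> {1, t})"
proof (cases "snd ` S = {1..t}")
  case True
  have "1 \<le> t" using st by simp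
  then obtain p where "p \<in> {1, s}" "S = {p} \<times> {1..t}"
    by (rule minimum_resolving_is_outer_column[OF crs _ True card])
  then show ?thesis using v by auto
next
  case False
  then have full: "fst ` S = {1..s}"
    using resolving_meets_all_lines[OF crs] st by auto
  have "card (fst ` S) \<le> card S"
    using finite_connected_resolving_set[OF crs] by (rule card_image_le)
  then have "s = t" using full card st by simp
  have "snd ` prod.swap ` S = {1..s}" using full by (simp add: image_image)
  moreover have "card (prod.swap ` S) = s"
    using card \<open>s = t\<close> by (simp add: card_image)
  moreover have "1 \<le> s" using st by simp
  ultimately obtain p where p: "p \<in> {1, t}" "prod.swap ` S = {p} \<times> {1..s}"
    using minimum_resolving_is_outer_column[OF connected_resolving_set_swap[OF crs]] by metis
  have "prod.swap v \<in> {p} \<times> {1..s}" using v p(2) by (metis imageI)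
  then have "snd v \<in> {1, t}" using p(1) by (cases v) auto
  then show ?thesis using \<open>s = t\<close> by blast
qed

lemma cdim_grid:
  assumes "s \<ge> t" "t \<ge> 2"
  shows "cdim (grid s t) = t"
  unfolding cdim_def
proof (rule cInf_eq_minimum)
  have "connected_resolving_set (grid s t) ({1} \<times> {1..t})"
    by (rule outer_column_resolving) (use assms in auto)
  moreover have "card ({1::nat} \<times> {1..t}) = t" by simp
  ultimately show "t \<in> card ` {S. connected_resolving_set (grid s t) S}"
    by (intro image_eqI[of _ card]) auto
  fix n assume "n \<in> card ` {S. connected_resolving_set (grid s t) S}"
  then show "t \<le> n" using card_connected_resolving_set_ge assms by blast
qed

lemma cdim_at_grid_border:
  assumes "s \<ge> t" "t \<ge> 2" and v: "(i, j) \<in> {1..s} \<times> {1..t}"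
    and border: "i \<in> {1, s} \<or> (s = t \<and> j \<in> {1, t})"
  shows "cdim_at (grid s t) (i, j) = t"
proof -
  have "\<exists>S. connected_resolving_set (grid s t) S \<and> (i, j) \<in> S \<and> card S = t"
    using border
  proof
    assume "i \<in> {1, s}"
    then have "connected_resolving_set (grid s t) ({i} \<times> {1..t})"
      by (rule outer_column_resolving) (use assms in auto)
    then show ?thesis using v by (intro exI[of _ "{i} \<times> {1..t}"]) auto
  next
    assume sq: "s = t \<and> j \<in> {1, t}"
    then have "connected_resolving_set (grid t s) ({j} \<times> {1..s})"
      by (intro outer_column_resolving) (use assms in auto)
    then have "connected_resolving_set (grid s t) ({1..s} \<times> {j})"
      using connected_resolving_set_swap product_swap by metis
    then show ?thesis using v sq by (intro exI[of _ "{1..s} \<times> {j}"]) auto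
  qed
  then show ?thesis
    using cdim_at_eqI card_connected_resolving_set_ge assms(1,2) by metis
qed

lemma cdim_at_grid_inner:
  assumes st: "s \<ge> t" "t \<ge> 2" and v: "(i, j) \<in> {1..s} \<times> {1..t}"
    and inner: "i \<notin> {1, s}" "\<not> (s = t \<and> j \<in> {1, t})"
  shows "cdim_at (grid s t) (i, j) = t + 1"
proof (rule cdim_at_eqI)
  let ?S = "insert (i + 1, 1) ({i} \<times> {1..t})"
  show "connected_resolving_set (grid s t) ?S"
    by (rule thickened_column_resolving) (use v inner st in auto)
  show "(i, j) \<in> ?S" using v by simp
  show "card ?S = t + 1" by (subst card_insert_disjoint) auto
  fix S assume S: "connected_resolving_set (grid s t) S" "(i, j) \<in> S"
  then have "card S \<noteq> t"
    using minimum_resolving_on_border[OF S(1) _ st S(2)] inner by auto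
  then show "t + 1 \<le> card S"
    using card_connected_resolving_set_ge[OF S(1) st] by simp
qed

theorem theorem5p18:
  fixes s t :: nat and G :: "(nat \<times> nat) pair_pre_digraph" and L :: "(nat \<times> nat) set"
  assumes "s \<ge> t" and "t \<ge> 2"
    and "G = cartesian_product (path_graph s) (path_graph t)"
    and "L = (\<Union>i\<in>{1..t}. {(1, i), (s, i)})"
  shows "cdim G = t \<and>
         (\<forall>v\<in>pverts G.
           ((s = t \<and> degree G v \<le> 3 \<or> s > t \<and> v \<in> L) \<longrightarrow> cdim_at G v = t) \<and>
           ((s = t \<and> degree G v = 4 \<or> s > t \<and> v \<notin> L) \<longrightarrow> cdim_at G v = t + 1))"
proof (intro conjI ballI impI)
  show "cdim G = t" using cdim_grid assms(1-3) by simp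
  fix v assume "v \<in> pverts G"
  then have "v \<in> {1..s} \<times> {1..t}"
    unfolding assms(3) pverts_grid .
  then obtain i j where v: "v = (i, j)" and ij: "(i, j) \<in> {1..s} \<times> {1..t}"
    by (metis surj_pair)
  have L: "v \<in> L \<longleftrightarrow> i \<in> {1, s}"
    using ij unfolding assms(4) v by auto
  have border: "degree G v \<le> 3" if "i \<in> {1, s} \<or> j \<in> {1, t}"
    using degree_grid_border[OF ij that] unfolding assms(3) v .
  have inner: "degree G v \<ge> 4" if "\<not> (i \<in> {1, s} \<or> j \<in> {1, t})"
    unfolding assms(3) v by (rule degree_grid_inner) (use that ij in auto)
  show "cdim_at G v = t" if "s = t \<and> degree G v \<le> 3 \<or> s > t \<and> v \<in> L"
  proof -
    have "i \<in> {1, s} \<or> (s = t \<and> j \<in> {1, t})"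
      using that inner L by linarith
    then show ?thesis
      unfolding assms(3) v by (rule cdim_at_grid_border[OF assms(1,2) ij])
  qed
  show "cdim_at G v = t + 1" if "s = t \<and> degree G v = 4 \<or> s > t \<and> v \<notin> L"
  proof -
    have "i \<notin> {1, s}" "\<not> (s = t \<and> j \<in> {1, t})"
      using that border L by linarith+
    then show ?thesis
      unfolding assms(3) v by (rule cdim_at_grid_inner[OF assms(1,2) ij])
  qed
qed

end
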